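(* For finite graphs (loops and multiple edges allowed): (a) For any graphs $G_1,G_2$ with disjoint union $G_1\cup G_2$, $\omega_{G_1\cup G_2}(\beta)=\omega_{G_1}(\beta)\,\omega_{G_2}(\beta)$. (b) For every graph $G=(V,E)$ and every $e\in E$ that is not a loop, $\omega_G(\beta)=\omega_{G\backslash e}(\beta)+\beta\,\omega_{G/e}(\beta)$. (c) For the graph $B_n$ with a single vertex and $n\ge0$ loops, $\omega_{B_n}(\beta)=1+(2n-1)\beta$. (d) For every graph $G$, $\omega_G(\beta)=\omega_{\mathrm{core}(G)}(\beta)$. (e) For every graph $G$, $\omega_G(\beta)$ is a polynomial of degree $|V_{\mathrm{core}(G)}|$, where $V_{\mathrm{core}(G)}$ is the vertex set of $\mathrm{core}(G)$; its leading coefficient is $\prod_{i\in V_{\mathrm{core}(G)}}(d_i-1)$, where $d_i$ is the degree of $i$ in $\mathrm{core}(G)$, and its constant term is $1$. (f) For every graph $G=(V,E)$ and $m\ge1$, let $G^{(m)}$ be the graph obtained from $G$ by subdividing each edge into $m$ edges. Then $$\omega_{G^{(m)}}(\beta)=(1+\beta+\cdots+\beta^{m-1})^{|E|-|V|}\,\omega_G(\beta^m).$$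
   Context: Graphs are finite undirected multigraphs; loops and multiple edges are allowed. The degree of a vertex is the number of edge-ends at it (a loop counts twice). For $s\subset E$, $d_i(s)$ is the degree of vertex $i$ in the spanning subgraph $(V,s)$. $G\backslash e$ is $G$ with $e$ deleted; $G/e$ is $G$ with $e$ contracted (the endpoints are merged, $e$ is removed, and any edges parallel to $e$ become loops). The core $\mathrm{core}(G)$ of $G$ is the graph obtained by repeatedly removing a vertex of degree one (together with its incident edge) until no vertex of degree one remains; e.g. the core of a tree is a single vertex without edges. The polynomials $f_n(x)$, $n\ge 0$, are defined by $f_0(x)=1$, $f_1(x)=0$, $f_{n+1}(x)=x f_n(x)+f_{n-1}(x)$ for $n\ge1$. Put $\theta_G(\beta,\gamma):=\sum_{s\subset E}\beta^{|s|}\prod_{i\in V}f_{d_i(s)}(\gamma)$ and $$\omega_G(\beta):=\frac{\theta_G(\beta,2\sqrt{-1})}{(1-\beta)^{|E|-|V|}},$$ which is a polynomial in $\mathbb{Z}[\beta]$. *)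

theory Defs
  imports
    Complex_Main
    "HOL-Library.Multiset"
    "HOL-Computational_Algebra.Computational_Algebra"
begin

text \<open>
  An edge carries the two-element multiset of its endpoints, a loop at \<open>v\<close> being
  \<open>{#v, v#}\<close>; the values of \<open>ends\<close> outside \<open>edges\<close> are irrelevant.
\<close>

record ('v, 'e) mgraph =
  verts :: "'v set"
  edges :: "'e set"
  ends :: "'e \<Rightarrow> 'v multiset"

definition finite_mgraph :: "('v, 'e) mgraph \<Rightarrow> bool" where
  "finite_mgraph G \<longleftrightarrow> finite (verts G) \<and> finite (edges G) \<and>
     (\<forall>e\<in>edges G. size (ends G e) = 2 \<and> set_mset (ends G e) \<subseteq> verts G)"

definition is_loop :: "('v, 'e) mgraph \<Rightarrow> 'e \<Rightarrow> bool" where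
  "is_loop G e \<longleftrightarrow> (\<exists>v. ends G e = {#v, v#})"

definition vdeg :: "('v, 'e) mgraph \<Rightarrow> 'e set \<Rightarrow> 'v \<Rightarrow> nat" where
  "vdeg G s v = (\<Sum>e\<in>s. count (ends G e) v)"

definition disjoint_union ::
    "('v, 'e) mgraph \<Rightarrow> ('w, 'f) mgraph \<Rightarrow> ('v + 'w, 'e + 'f) mgraph" where
  "disjoint_union G H =
     \<lparr> verts = verts G <+> verts H,
       edges = edges G <+> edges H,
       ends = case_sum (\<lambda>e. image_mset Inl (ends G e)) (\<lambda>f. image_mset Inr (ends H f)) \<rparr>"

definition delete_edge :: "('v, 'e) mgraph \<Rightarrow> 'e \<Rightarrow> ('v, 'e) mgraph" where
  "delete_edge G e = \<lparr> verts = verts G, edges = edges G - {e}, ends = ends G \<rparr>"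

text \<open>
  The vertices of the contraction are the classes of the equivalence relation that
  identifies the endpoints of \<open>e\<close>.
\<close>

definition merge_class :: "('v, 'e) mgraph \<Rightarrow> 'e \<Rightarrow> 'v \<Rightarrow> 'v set" where
  "merge_class G e v = (if v \<in># ends G e then set_mset (ends G e) else {v})"

definition contract_edge :: "('v, 'e) mgraph \<Rightarrow> 'e \<Rightarrow> ('v set, 'e) mgraph" where
  "contract_edge G e =
     \<lparr> verts = merge_class G e ` verts G,
       edges = edges G - {e},
       ends = (\<lambda>f. image_mset (merge_class G e) (ends G f)) \<rparr>"

definition bouquet :: "nat \<Rightarrow> (unit, nat) mgraph" where
  "bouquet n = \<lparr> verts = {()}, edges = {..<n}, ends = (\<lambda>_. {#(), ()#}) \<rparr>"

definition delete_vertex :: "('v, 'e) mgraph \<Rightarrow> 'v \<Rightarrow> ('v, 'e) mgraph" where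
  "delete_vertex G v =
     \<lparr> verts = verts G - {v}, edges = {e \<in> edges G. v \<notin># ends G e}, ends = ends G \<rparr>"

definition leaf_removal :: "('v, 'e) mgraph \<Rightarrow> ('v, 'e) mgraph \<Rightarrow> bool" where
  "leaf_removal G H \<longleftrightarrow> (\<exists>v\<in>verts G. vdeg G (edges G) v = 1 \<and> H = delete_vertex G v)"

text \<open>
  A relation and not a function: the vertices that survive depend on the order of the removals
  (either end of a single edge may remain), so the core is determined only up to isomorphism.
\<close>

definition is_core :: "('v, 'e) mgraph \<Rightarrow> ('v, 'e) mgraph \<Rightarrow> bool" where
  "is_core G H \<longleftrightarrow> leaf_removal\<^sup>*\<^sup>* G H \<and> (\<forall>v\<in>verts H. vdeg H (edges H) v \<noteq> 1)"

text \<open>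
  Each edge \<open>e\<close> becomes a path with edges \<open>(e, 0), \<dots>, (e, m - 1)\<close> and inner vertices
  \<open>(e, 1), \<dots>, (e, m - 1)\<close>. The choice of the end at which the path starts affects the result
  only up to isomorphism.
\<close>

definition edge_pair :: "('v, 'e) mgraph \<Rightarrow> 'e \<Rightarrow> 'v \<times> 'v" where
  "edge_pair G e = (SOME p. ends G e = {#fst p, snd p#})"

definition path_vertex :: "nat \<Rightarrow> ('v, 'e) mgraph \<Rightarrow> 'e \<Rightarrow> nat \<Rightarrow> 'v + 'e \<times> nat" where
  "path_vertex m G e k =
     (if k = 0 then Inl (fst (edge_pair G e))
      else if k = m then Inl (snd (edge_pair G e))
      else Inr (e, k))"

definition subdivide :: "nat \<Rightarrow> ('v, 'e) mgraph \<Rightarrow> ('v + 'e \<times> nat, 'e \<times> nat) mgraph" where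
  "subdivide m G =
     \<lparr> verts = verts G <+> edges G \<times> {1..<m},
       edges = edges G \<times> {..<m},
       ends = (\<lambda>(e, k). {#path_vertex m G e k, path_vertex m G e (Suc k)#}) \<rparr>"

fun f_poly :: "nat \<Rightarrow> 'a::comm_ring_1 poly" where
  "f_poly 0 = 1"
| "f_poly (Suc 0) = 0"
| "f_poly (Suc (Suc n)) = [:0, 1:] * f_poly (Suc n) + f_poly n"

definition theta :: "('v, 'e) mgraph \<Rightarrow> 'a::comm_ring_1 \<Rightarrow> 'a \<Rightarrow> 'a" where
  "theta G \<beta> \<gamma> =
     (\<Sum>s\<in>Pow (edges G). \<beta> ^ card s * (\<Prod>i\<in>verts G. poly (f_poly (vdeg G s i)) \<gamma>))"

text \<open>
  Here \<open>\<beta>\<close> is the indeterminate \<open>[:0, 1:]\<close>. The exponent of \<open>1 - \<beta>\<close> may be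
  negative, so the quotient is formed in the field of rational functions; \<open>omega\<close> is the
  integer polynomial it is equal to.
\<close>

definition omega_fract :: "('v, 'e) mgraph \<Rightarrow> complex poly fract" where
  "omega_fract G =
     to_fract (theta G [:0, 1:] [:2 * \<i>:]) /
     to_fract (1 - [:0, 1:]) powi (int (card (edges G)) - int (card (verts G)))"

definition omega :: "('v, 'e) mgraph \<Rightarrow> int poly" where
  "omega G = (THE p. omega_fract G = to_fract (map_poly of_int p))"


lemma size_2_mset_eq: "size M = 2 \<Longrightarrow> \<exists>u w. M = {#u, w#}"
proof -
  assume M: "size M = 2"
  then obtain u N where N: "M = add_mset u N"
    by (metis numeral_2_eq_2 size_eq_Suc_imp_eq_union)
  with M have "size N = 1" by simp
  then obtain w where "N = {#w#}" using size_1_singleton_mset by blast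
  with N show ?thesis by blast
qed

lemma ends_edge_pair:
  assumes "finite_mgraph G" "e \<in> edges G"
  shows "ends G e = {#fst (edge_pair G e), snd (edge_pair G e)#}"
proof -
  obtain u w where "ends G e = {#u, w#}"
    using assms size_2_mset_eq unfolding finite_mgraph_def by blast
  then have "ends G e = {#fst (u, w), snd (u, w)#}" by simp
  then show ?thesis unfolding edge_pair_def by (rule someI)
qed

lemma finite_mgraph_disjoint_union:
  "finite_mgraph G \<Longrightarrow> finite_mgraph H \<Longrightarrow> finite_mgraph (disjoint_union G H)"
  unfolding finite_mgraph_def disjoint_union_def by fastforce

lemma finite_mgraph_delete_edge: "finite_mgraph G \<Longrightarrow> finite_mgraph (delete_edge G e)"
  unfolding finite_mgraph_def delete_edge_def by auto

lemma finite_mgraph_contract_edge: "finite_mgraph G \<Longrightarrow> finite_mgraph (contract_edge G e)"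
  unfolding finite_mgraph_def contract_edge_def by auto

lemma finite_mgraph_bouquet: "finite_mgraph (bouquet n)"
  unfolding finite_mgraph_def bouquet_def by auto

lemma finite_mgraph_delete_vertex: "finite_mgraph G \<Longrightarrow> finite_mgraph (delete_vertex G v)"
  unfolding finite_mgraph_def delete_vertex_def by auto

lemma finite_mgraph_subdivide:
  assumes "finite_mgraph G"
  shows "finite_mgraph (subdivide m G)"
proof -
  have "fst (edge_pair G e) \<in> verts G" "snd (edge_pair G e) \<in> verts G" if "e \<in> edges G" for e
    using ends_edge_pair[OF assms that] assms that
    unfolding finite_mgraph_def by (metis insert_subset set_mset_add_mset_insert)+
  then show ?thesis
    using assms unfolding finite_mgraph_def subdivide_def path_vertex_def by auto
qed

lemma is_core_exists: "finite_mgraph G \<Longrightarrow> \<exists>H. is_core G H"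
proof (induction "card (verts G)" arbitrary: G rule: less_induct)
  case less
  show ?case
  proof (cases "\<exists>v\<in>verts G. vdeg G (edges G) v = 1")
    case False
    then have "is_core G G" unfolding is_core_def by auto
    then show ?thesis by blast
  next
    case True
    then obtain v where v: "v \<in> verts G" "vdeg G (edges G) v = 1" by blast
    have "finite (verts G)" using less.prems unfolding finite_mgraph_def by blast
    then have "card (verts (delete_vertex G v)) < card (verts G)"
      using v(1) unfolding delete_vertex_def by (simp only: mgraph.simps) (rule card_Diff1_less)
    then obtain H where "is_core (delete_vertex G v) H"
      using less.hyps finite_mgraph_delete_vertex[OF less.prems] by blast
    moreover have "leaf_removal G (delete_vertex G v)"
      using v unfolding leaf_removal_def by blast
    ultimately have "is_core G H"
      unfolding is_core_def by (meson converse_rtranclp_into_rtranclp)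
    then show ?thesis by blast
  qed
qed

end

theory Submission
  imports Defs
begin

text \<open>
  At \<open>\<gamma> = 2\<i>\<close> the recursion for \<open>f\<^sub>n\<close> has a double characteristic root, and
  \<open>f\<^sub>n(2\<i>) = (1 - n) \<i>\<^sup>n\<close>. By the handshake lemma the powers of \<open>\<i>\<close> combine to a sign, so that
  \<open>\<theta>(\<beta>, 2\<i>) = (\<Sum>s. (- \<beta>) ^ card s * (\<Prod>i. 1 - d\<^sub>i(s)))\<close> (\<open>theta_2i\<close>). All parts of the theorem
  are read off from this sum with integer coefficients.

  Multiplying out the product over the vertices shows that \<open>(1 - \<beta>) ^ card E\<close> divides
  \<open>(1 - \<beta>) ^ card V * \<theta>\<close> (\<open>power_dvd_sum_supersets\<close>). Hence \<open>\<omega>\<close> is an integer polynomial, and it is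
  determined by the equation \<open>(1 - \<beta>) ^ card V * \<theta> = (1 - \<beta>) ^ card E * \<omega>\<close> (\<open>omega_eqI\<close>,
  \<open>omega_spec\<close>). Each statement about \<open>\<omega>\<close> thereby becomes one about \<open>\<theta>\<close> together with a count of
  vertices and edges.

  For these, the factor \<open>1 - d\<close> of a vertex does the work. It vanishes at \<open>d = 1\<close>, so a leaf may be
  removed, and a subdivided edge contributes only when all or none of its pieces are present. The
  identity \<open>(1 - a) (1 - b) - a b = 1 - a - b\<close> is the deletion-contraction rule. The top coefficient
  of \<open>\<theta>\<close> is \<open>\<plusminus> (\<Prod>i. 1 - d\<^sub>i)\<close>, which is nonzero exactly when there are no leaves; so the degree and
  the leading coefficient of \<open>\<omega>\<close> can be computed on the core.
\<close>

section \<open>Sums over edge sets\<close>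

lemma sum_Pow_insert:
  fixes F :: "'e set \<Rightarrow> 'a::comm_monoid_add"
  assumes "finite E" "e \<notin> E"
  shows "(\<Sum>s\<in>Pow (insert e E). F s) = (\<Sum>s\<in>Pow E. F s + F (insert e s))"
proof -
  have "inj_on (insert e) (Pow E)"
    using assms(2) by (intro inj_onI) (metis PowD insert_ident subsetD)
  moreover have "Pow E \<inter> insert e ` Pow E = {}"
    using assms(2) by blast
  ultimately show ?thesis
    using assms(1) by (simp add: Pow_insert sum.union_disjoint sum.reindex sum.distrib)
qed

lemma sum_supersets_power_card:
  fixes x :: "'a::comm_ring_1"
  assumes "finite E" "D \<subseteq> E"
  shows "(\<Sum>s | D \<subseteq> s \<and> s \<subseteq> E. x ^ card s) = x ^ card D * (1 + x) ^ card (E - D)"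
proof -
  have fin: "finite D" "finite (E - D)"
    using assms finite_subset by auto
  have "(\<Sum>s | D \<subseteq> s \<and> s \<subseteq> E. x ^ card s) = (\<Sum>t\<in>Pow (E - D). x ^ card (D \<union> t))"
    by (rule sum.reindex_bij_witness[where i = "\<lambda>t. D \<union> t" and j = "\<lambda>s. s - D"])
      (use assms in \<open>auto simp: Un_absorb1\<close>)
  also have "\<dots> = (\<Sum>t\<in>Pow (E - D). x ^ card D * x ^ card t)"
  proof (rule sum.cong[OF refl])
    fix t assume "t \<in> Pow (E - D)"
    then have "finite t" "D \<inter> t = {}"
      using fin finite_subset by auto
    then show "x ^ card (D \<union> t) = x ^ card D * x ^ card t"
      using fin by (simp add: card_Un_disjoint power_add)
  qed
  also have "\<dots> = x ^ card D * (\<Prod>e\<in>E - D. x + 1)"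
    by (subst prod_add[OF fin(2)]) (simp add: sum_distrib_left)
  finally show ?thesis
    by (simp add: add.commute)
qed

text \<open>
  This is the reason why \<open>\<omega>\<close> is a polynomial. Multiplying out
  \<open>\<Prod>v\<in>V. 1 - (\<Sum>e\<in>s. c e v)\<close> selects, for each \<open>v\<close>, either nothing or one edge that \<open>s\<close> then
  has to contain; at most \<open>card V\<close> edges get selected, and summing \<open>x ^ card s\<close> over
  the supersets of a selected set leaves a factor \<open>1 + x\<close> for every other edge. The set \<open>D\<close>
  collects the edges selected so far, so that the expansion becomes an induction on \<open>V\<close>. Writing
  the factor \<open>(1 + x) ^ (card D + card V)\<close> on the right avoids a truncated difference of exponents.
\<close>

lemma power_dvd_sum_supersets:
  fixes x :: "'a::comm_ring_1" and c :: "'e \<Rightarrow> 'v \<Rightarrow> 'a"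
  assumes "finite E" "finite V" "D \<subseteq> E"
  shows "(1 + x) ^ card E dvd
    (1 + x) ^ (card D + card V) *
      (\<Sum>s | D \<subseteq> s \<and> s \<subseteq> E. x ^ card s * (\<Prod>v\<in>V. 1 - (\<Sum>e\<in>s. c e v)))"
  using assms(2,3)
proof (induction V arbitrary: D rule: finite_induct)
  case empty
  then have "card D + card (E - D) = card E"
    using assms(1) by (metis card_Diff_subset card_mono finite_subset le_add_diff_inverse)
  then show ?case
    using empty assms(1)
    by (simp add: sum_supersets_power_card mult.left_commute flip: power_add)
next
  case (insert v V)
  let ?P = "\<lambda>s. x ^ card s * (\<Prod>v\<in>V. 1 - (\<Sum>e\<in>s. c e v))"
  let ?A = "\<lambda>D. \<Sum>s | D \<subseteq> s \<and> s \<subseteq> E. ?P s"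
  let ?k = "card D + card V + 1"
  have finE: "finite {s. D \<subseteq> s \<and> s \<subseteq> E}"
    using assms(1) by (rule_tac finite_subset[of _ "Pow E"]) auto
  \<comment> \<open>The sum over the edge chosen at \<open>v\<close> is pulled out; the chosen edge joins \<open>D\<close>.\<close>
  have "(\<Sum>s | D \<subseteq> s \<and> s \<subseteq> E. \<Sum>e\<in>s. c e v * ?P s) =
      (\<Sum>s | D \<subseteq> s \<and> s \<subseteq> E. \<Sum>e | e \<in> E \<and> e \<in> s. c e v * ?P s)"
    by (intro sum.cong) auto
  also have "\<dots> = (\<Sum>e\<in>E. \<Sum>s | s \<in> {s. D \<subseteq> s \<and> s \<subseteq> E} \<and> e \<in> s. c e v * ?P s)"
    using finE assms(1) by (rule sum.swap_restrict)
  also have "\<dots> = (\<Sum>e\<in>E. c e v * ?A (insert e D))"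
    by (intro sum.cong refl) (auto simp: sum_distrib_left intro!: sum.cong)
  finally have swap: "(\<Sum>s | D \<subseteq> s \<and> s \<subseteq> E. \<Sum>e\<in>s. c e v * ?P s) =
      (\<Sum>e\<in>E. c e v * ?A (insert e D))" .
  have "(\<Sum>s | D \<subseteq> s \<and> s \<subseteq> E. x ^ card s * (\<Prod>v\<in>insert v V. 1 - (\<Sum>e\<in>s. c e v))) =
      (\<Sum>s | D \<subseteq> s \<and> s \<subseteq> E. ?P s - (\<Sum>e\<in>s. c e v * ?P s))"
    using insert.hyps
    by (intro sum.cong refl) (simp add: algebra_simps sum_distrib_left sum_distrib_right)
  also have "\<dots> = ?A D - (\<Sum>e\<in>E. c e v * ?A (insert e D))"
    by (simp add: sum_subtractf swap)
  finally have drop_factor: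
    "(\<Sum>s | D \<subseteq> s \<and> s \<subseteq> E. x ^ card s * (\<Prod>v\<in>insert v V. 1 - (\<Sum>e\<in>s. c e v))) =
      ?A D - (\<Sum>e\<in>E. c e v * ?A (insert e D))" .
  have pull: "K * (\<Sum>e\<in>E. g e * B e) = (\<Sum>e\<in>E. g e * (K * B e))" for K and g B :: "'e \<Rightarrow> 'a"
    by (simp add: sum_distrib_left mult.left_commute)
  have "card D + card (insert v V) = ?k"
    using insert.hyps by simp
  with drop_factor have expand:
    "(1 + x) ^ (card D + card (insert v V)) *
       (\<Sum>s | D \<subseteq> s \<and> s \<subseteq> E. x ^ card s * (\<Prod>v\<in>insert v V. 1 - (\<Sum>e\<in>s. c e v))) =
     (1 + x) ^ ?k * ?A D - (\<Sum>e\<in>E. c e v * ((1 + x) ^ ?k * ?A (insert e D)))"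
    by (simp only: right_diff_distrib pull)
  have weaken: "(1 + x) ^ card E dvd (1 + x) ^ ?k * ?A D'"
    if "D' \<subseteq> E" "card D' \<le> card D + 1" for D'
  proof -
    have "(1 + x) ^ (card D' + card V) dvd (1 + x) ^ ?k"
      using that by (intro le_imp_power_dvd) simp
    then show ?thesis
      using insert.IH[OF that(1)] by (meson dvd_trans dvd_refl mult_dvd_mono)
  qed
  have "card (insert e D) \<le> card D + 1" for e
    using card_insert_le_m1[of "card D + 1" D e] by simp
  then show ?case
    unfolding expand using insert.prems
    by (intro dvd_diff dvd_sum dvd_mult weaken) auto
qed

section \<open>The partition function at \<open>\<gamma> = 2\<i>\<close>\<close>

text \<open>
  The value \<open>\<theta>(x, 2\<i>)\<close>, rewritten so that it makes sense over every commutative ring: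
  \<open>theta_2i\<close> shows that both agree over complex polynomials.
\<close>

definition signed_theta :: "('v, 'e) mgraph \<Rightarrow> 'a::comm_ring_1 \<Rightarrow> 'a" where
  "signed_theta G x =
     (\<Sum>s\<in>Pow (edges G). (- x) ^ card s * (\<Prod>i\<in>verts G. 1 - of_nat (vdeg G s i)))"

text \<open>
  At \<open>\<gamma> = 2\<i>\<close> the characteristic polynomial \<open>t\<^sup>2 - \<gamma> t - 1\<close> of the recursion is the square
  \<open>(t - \<i>)\<^sup>2\<close>, so its solutions are \<open>(a + b n) \<i>\<^sup>n\<close>; the initial values give \<open>a = 1\<close>, \<open>b = - 1\<close>.
\<close>

lemma poly_f_poly_2i: "poly (f_poly n) [:2 * \<i>:] = (1 - of_nat n) * [:\<i>:] ^ n"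
proof (induction n rule: f_poly.induct)
  case (3 n)
  have "[:\<i>:] * [:\<i>:] = - 1"
    by (simp add: one_pCons)
  moreover have "[:2 * \<i>:] = 2 * [:\<i>:]"
    by (simp add: numeral_poly)
  ultimately show ?case
    using 3 by (simp add: algebra_simps)
qed simp_all

lemma sum_vdeg:
  assumes "finite_mgraph G" "s \<subseteq> edges G"
  shows "(\<Sum>i\<in>verts G. vdeg G s i) = 2 * card s"
proof -
  have "(\<Sum>i\<in>verts G. count (ends G e) i) = 2" if "e \<in> s" for e
  proof -
    have "(\<Sum>i\<in>verts G. count (ends G e) i) = (\<Sum>i\<in>set_mset (ends G e). count (ends G e) i)"
      using assms that unfolding finite_mgraph_def
      by (intro sum.mono_neutral_right) (auto simp: not_in_iff)
    then show ?thesis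
      using assms that unfolding finite_mgraph_def
      by (metis size_multiset_overloaded_eq subsetD)
  qed
  then show ?thesis
    unfolding vdeg_def by (subst sum.swap) simp
qed

text \<open>
  The powers of \<open>\<i>\<close> from the vertices multiply to \<open>\<i> ^ (2 * card s) = (- 1) ^ card s\<close> by the
  handshake lemma, which turns \<open>x\<close> into \<open>- x\<close>.
\<close>

lemma theta_2i:
  assumes "finite_mgraph G"
  shows "theta G x [:2 * \<i>:] = signed_theta G x"
  unfolding theta_def signed_theta_def
proof (rule sum.cong[OF refl])
  fix s assume "s \<in> Pow (edges G)"
  then have "(\<Prod>i\<in>verts G. [:\<i>:] ^ vdeg G s i) = ([:\<i>:] ^ 2) ^ card s"
    using sum_vdeg[OF assms, of s] by (simp add: power_mult flip: power_sum)
  also have "[:\<i>:] ^ 2 = - 1"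
    by (simp add: power2_eq_square one_pCons)
  finally show "x ^ card s * (\<Prod>i\<in>verts G. poly (f_poly (vdeg G s i)) [:2 * \<i>:]) =
      (- x) ^ card s * (\<Prod>i\<in>verts G. 1 - of_nat (vdeg G s i))"
    by (simp add: poly_f_poly_2i prod.distrib power_minus[of x])
qed

lemma power_dvd_signed_theta:
  fixes x :: "'a::comm_ring_1"
  assumes "finite_mgraph G"
  shows "(1 - x) ^ card (edges G) dvd (1 - x) ^ card (verts G) * signed_theta G x"
proof -
  have "finite (edges G)" "finite (verts G)"
    using assms unfolding finite_mgraph_def by auto
  from power_dvd_sum_supersets[OF this, of "{}" "- x" "\<lambda>e v. of_nat (count (ends G e) v)"]
  show ?thesis
    unfolding signed_theta_def vdeg_def by (simp add: Pow_def)
qed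

section \<open>The polynomial \<open>\<omega>\<close> without fractions\<close>

lemma power_int_diff_eq_iff:
  fixes a b c :: "'a::field"
  assumes "c \<noteq> 0"
  shows "a / c powi (int m - int n) = b \<longleftrightarrow> c ^ n * a = c ^ m * b"
  using assms by (auto simp: power_int_diff field_simps)

lemma to_fract_power: "to_fract (p ^ n) = to_fract p ^ n"
  by (induction n) simp_all

lemma of_int_poly_mult:
  "map_poly of_int (p * q) = (map_poly of_int p * map_poly of_int q :: complex poly)"
  by (rule poly_eqI) (simp add: coeff_map_poly coeff_mult)

lemma of_int_poly_diff:
  "map_poly of_int (p - q) = (map_poly of_int p - map_poly of_int q :: complex poly)"
  by (rule poly_eqI) (simp add: coeff_map_poly)

lemma of_int_poly_sum:
  "map_poly of_int (\<Sum>i\<in>A. p i) = (\<Sum>i\<in>A. map_poly of_int (p i) :: complex poly)"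
  by (rule poly_eqI) (simp add: coeff_map_poly coeff_sum)

lemma of_int_poly_prod:
  "map_poly of_int (\<Prod>i\<in>A. p i) = (\<Prod>i\<in>A. map_poly of_int (p i) :: complex poly)"
  by (induction A rule: infinite_finite_induct) (simp_all add: of_int_poly_mult)

lemma of_int_poly_power:
  "map_poly of_int (p ^ n) = (map_poly of_int p ^ n :: complex poly)"
  by (induction n) (simp_all add: of_int_poly_mult)

lemma of_int_poly_of_nat: "map_poly of_int (of_nat n) = (of_nat n :: complex poly)"
  by (simp add: of_nat_poly map_poly_pCons)

lemma of_int_poly_eq_iff:
  "map_poly of_int p = (map_poly of_int q :: complex poly) \<longleftrightarrow> p = q"
  by (auto simp: poly_eq_iff coeff_map_poly)

lemma of_int_poly_signed_theta:
  "map_poly of_int (signed_theta G [:0, 1:]) = (signed_theta G [:0, 1:] :: complex poly)"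
proof -
  have "map_poly of_int (- [:0, 1:]) = (- [:0, 1:] :: complex poly)"
    by (simp add: map_poly_pCons)
  then show ?thesis
    unfolding signed_theta_def
    by (simp only: of_int_poly_sum of_int_poly_mult of_int_poly_power of_int_poly_prod
        of_int_poly_diff of_int_poly_of_nat map_poly_1' of_int_1)
qed

text \<open>
  Clearing denominators in the definition of \<open>\<omega>\<close>: since both sides of the cleared equation
  have integer coefficients, the complex numbers disappear; putting the powers with exponents
  \<open>card V\<close> and \<open>card E\<close> on opposite sides avoids a negative exponent.
\<close>

lemma omega_fract_eq_iff:
  assumes "finite_mgraph G"
  shows "omega_fract G = to_fract (map_poly of_int p) \<longleftrightarrow>
    (1 - [:0, 1:]) ^ card (verts G) * signed_theta G [:0, 1:] =
    (1 - [:0, 1:]) ^ card (edges G) * p"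
proof -
  let ?x = "1 - [:0, 1:] :: complex poly"
  have hx: "?x = map_poly of_int (1 - [:0, 1:])"
    by (simp only: of_int_poly_diff) (simp add: map_poly_pCons)
  have "to_fract ?x \<noteq> 0"
    by (simp add: one_pCons)
  then have "omega_fract G = to_fract (map_poly of_int p) \<longleftrightarrow>
      to_fract ?x ^ card (verts G) * to_fract (signed_theta G [:0, 1:]) =
      to_fract ?x ^ card (edges G) * to_fract (map_poly of_int p)"
    unfolding omega_fract_def theta_2i[OF assms] by (rule power_int_diff_eq_iff)
  also have "\<dots> \<longleftrightarrow> ?x ^ card (verts G) * signed_theta G [:0, 1:] =
      ?x ^ card (edges G) * map_poly of_int p"
    by (simp only: to_fract_eq_iff flip: to_fract_power to_fract_mult)
  also have "\<dots> \<longleftrightarrow> (1 - [:0, 1:]) ^ card (verts G) * signed_theta G [:0, 1:] =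
    (1 - [:0, 1:]) ^ card (edges G) * p"
    unfolding hx
    by (simp only: of_int_poly_eq_iff flip: of_int_poly_signed_theta of_int_poly_mult of_int_poly_power)
  finally show ?thesis .
qed

lemma omega_eqI:
  assumes "finite_mgraph G"
    and "(1 - [:0, 1:]) ^ card (verts G) * signed_theta G [:0, 1:] =
      (1 - [:0, 1:]) ^ card (edges G) * p"
  shows "omega G = p"
  unfolding omega_def
proof (rule the_equality)
  show fr: "omega_fract G = to_fract (map_poly of_int p)"
    using assms omega_fract_eq_iff by blast
  show "q = p" if "omega_fract G = to_fract (map_poly of_int q)" for q
    using that fr by (simp add: of_int_poly_eq_iff)
qed

lemma omega_spec:
  assumes "finite_mgraph G"
  shows "(1 - [:0, 1:]) ^ card (verts G) * signed_theta G [:0, 1:] =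
    (1 - [:0, 1:]) ^ card (edges G) * omega G"
  using power_dvd_signed_theta[OF assms, of "[:0, 1:] :: int poly"] omega_eqI[OF assms]
  by (metis dvdE)

lemma omega_fract_eq_omega:
  assumes "finite_mgraph G"
  shows "omega_fract G = to_fract (map_poly of_int (omega G))"
  using omega_fract_eq_iff[OF assms] omega_spec[OF assms] by blast

section \<open>Disjoint unions\<close>

lemma sum_Pow_Plus:
  "(\<Sum>s\<in>Pow (A <+> B). F s) = (\<Sum>s\<in>Pow A. \<Sum>t\<in>Pow B. F (s <+> t))"
proof -
  have split: "(Inl -` u) <+> (Inr -` u) = u" if "u \<subseteq> A <+> B" for u
    using that by (auto elim!: PlusE)
  have "(\<Sum>s\<in>Pow (A <+> B). F s) = (\<Sum>(s, t)\<in>Pow A \<times> Pow B. F (s <+> t))"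
    by (rule sum.reindex_bij_witness[where i = "\<lambda>(s, t). s <+> t"
          and j = "\<lambda>u. (Inl -` u, Inr -` u)"]) (auto simp: split)
  then show ?thesis
    by (simp add: sum.cartesian_product)
qed

lemma count_image_mset_inj:
  assumes "inj f"
  shows "count (image_mset f M) (f v) = count M v"
  using assms by (induction M) (auto dest: injD)

lemma count_image_mset_Inl_Inr [simp]:
  "count (image_mset Inl M) (Inr w) = 0" "count (image_mset Inr N) (Inl v) = 0"
  by (auto simp: count_eq_zero_iff)

lemma vdeg_disjoint_union:
  assumes "finite s" "finite t"
  shows "vdeg (disjoint_union G H) (s <+> t) (Inl v) = vdeg G s v"
    and "vdeg (disjoint_union G H) (s <+> t) (Inr w) = vdeg H t w"
  using assms unfolding vdeg_def disjoint_union_def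
  by (simp_all add: sum.Plus count_image_mset_inj)

lemma signed_theta_disjoint_union:
  assumes "finite_mgraph G" "finite_mgraph H"
  shows "signed_theta (disjoint_union G H) x = signed_theta G x * signed_theta H x"
proof -
  have fin: "finite (edges G)" "finite (edges H)" "finite (verts G)" "finite (verts H)"
    using assms unfolding finite_mgraph_def by auto
  let ?w = "\<lambda>G s. (- x) ^ card s * (\<Prod>i\<in>verts G. 1 - of_nat (vdeg G s i))"
  let ?U = "disjoint_union G H"
  have U: "edges ?U = edges G <+> edges H" "verts ?U = verts G <+> verts H"
    unfolding disjoint_union_def by simp_all
  have "(- x) ^ card (s <+> t) *
      (\<Prod>i\<in>verts G <+> verts H. 1 - of_nat (vdeg ?U (s <+> t) i)) = ?w G s * ?w H t"
    if "s \<in> Pow (edges G)" "t \<in> Pow (edges H)" for s t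
  proof -
    have "finite s" "finite t"
      using that fin finite_subset by auto
    then show ?thesis
      using fin by (simp add: prod.Plus card_Plus power_add vdeg_disjoint_union mult_ac)
  qed
  then show ?thesis
    unfolding signed_theta_def U sum_Pow_Plus sum_product
    by (intro sum.cong refl) blast
qed

theorem omega_disjoint_union:
  assumes "finite_mgraph G" "finite_mgraph H"
  shows "omega (disjoint_union G H) = omega G * omega H"
proof (rule omega_eqI[OF finite_mgraph_disjoint_union[OF assms]])
  have "finite (edges G)" "finite (edges H)" "finite (verts G)" "finite (verts H)"
    using assms unfolding finite_mgraph_def by auto
  then have card: "card (verts (disjoint_union G H)) = card (verts G) + card (verts H)"
    "card (edges (disjoint_union G H)) = card (edges G) + card (edges H)"
    unfolding disjoint_union_def by (simp_all add: card_Plus)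
  have mult_eqs: "a * a' * (t * t') = b * b' * (p * p')" if "a * t = b * p" "a' * t' = b' * p'"
    for a a' b b' p p' t t' :: "int poly"
    using that by algebra
  show "(1 - [:0, 1:]) ^ card (verts (disjoint_union G H)) * signed_theta (disjoint_union G H) [:0, 1:] =
      (1 - [:0, 1:]) ^ card (edges (disjoint_union G H)) * (omega G * omega H)"
    unfolding card signed_theta_disjoint_union[OF assms] power_add
    by (rule mult_eqs[OF omega_spec[OF assms(1)] omega_spec[OF assms(2)]])
qed

section \<open>Deletion and contraction\<close>

lemma vdeg_insert:
  assumes "finite s" "e \<notin> s"
  shows "vdeg G (insert e s) v = count (ends G e) v + vdeg G s v"
  unfolding vdeg_def using assms by simp

text \<open>
  Contracting an edge \<open>{u, w}\<close> adds the degrees of its endpoints and leaves the others alone. The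
  classes \<open>{v}\<close> and \<open>{u, w}\<close> are never confused since \<open>u \<noteq> w\<close>.
\<close>

lemma count_merge_class:
  assumes "ends G e = {#u, w#}" "u \<noteq> w"
  shows "count (image_mset (merge_class G e) M) {u, w} = count M u + count M w"
    and "v \<noteq> u \<Longrightarrow> v \<noteq> w \<Longrightarrow> count (image_mset (merge_class G e) M) {v} = count M v"
  using assms by (induction M) (auto simp: merge_class_def insert_eq_iff)

lemma verts_contract_edge:
  assumes "ends G e = {#u, w#}" "{u, w} \<subseteq> verts G"
  shows "verts (contract_edge G e) = insert {u, w} ((\<lambda>v. {v}) ` (verts G - {u, w}))"
  using assms unfolding contract_edge_def merge_class_def by auto

lemma vdeg_contract_edge:
  assumes "ends G e = {#u, w#}" "u \<noteq> w"
  shows "vdeg (contract_edge G e) s {u, w} = vdeg G s u + vdeg G s w"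
    and "v \<noteq> u \<Longrightarrow> v \<noteq> w \<Longrightarrow> vdeg (contract_edge G e) s {v} = vdeg G s v"
  unfolding vdeg_def contract_edge_def
  using count_merge_class[OF assms] by (simp_all add: sum.distrib)

text \<open>
  Group the edge sets into pairs \<open>s\<close>, \<open>insert e s\<close> with \<open>e \<notin> s\<close>, and let \<open>a\<close> and \<open>b\<close> be the
  degrees of \<open>u\<close> and \<open>w\<close> in \<open>s\<close>. The pair contributes the factor \<open>(1 - a) (1 - b) - x a b\<close> at \<open>u\<close>
  and \<open>w\<close>; deletion contributes \<open>(1 - a) (1 - b)\<close>, contraction contributes \<open>1 - a - b\<close>, and the
  claim is \<open>(1 - a) (1 - b) - x a b = (1 - x) (1 - a) (1 - b) + x (1 - a - b)\<close>.
\<close>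

lemma signed_theta_delete_contract:
  fixes x :: "'r::comm_ring_1"
  assumes G: "finite_mgraph G" and e: "e \<in> edges G" and uw: "ends G e = {#u, w#}" "u \<noteq> w"
  shows "signed_theta G x =
    (1 - x) * signed_theta (delete_edge G e) x + x * signed_theta (contract_edge G e) x"
proof -
  define E where "E = edges G - {e}"
  define V where "V = verts G - {u, w}"
  have fin: "finite E" "finite V" and E: "edges G = insert e E" "e \<notin> E"
    and V: "verts G = insert u (insert w V)" "u \<notin> V" "w \<notin> V"
    using assms unfolding finite_mgraph_def E_def V_def by auto
  let ?d = "\<lambda>s v. of_nat (vdeg G s v)"
  let ?R = "\<lambda>s. \<Prod>i\<in>V. 1 - ?d s i"
  have R: "?R (insert e s) = ?R s" if "s \<in> Pow E" for s
  proof -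
    have "finite s" "e \<notin> s"
      using that fin(1) E(2) finite_subset by auto
    then show ?thesis
      using uw V by (intro prod.cong) (auto simp: vdeg_insert)
  qed
  have P: "(\<Prod>i\<in>verts G. 1 - ?d s i) = (1 - ?d s u) * (1 - ?d s w) * ?R s" for s
    using V fin(2) uw(2) by (simp add: mult_ac)
  have sG: "signed_theta G x =
    (\<Sum>s\<in>Pow E. (- x) ^ card s * ?R s * ((1 - ?d s u) * (1 - ?d s w) - x * (?d s u * ?d s w)))"
    unfolding signed_theta_def E(1) sum_Pow_insert[OF fin(1) E(2)]
  proof (rule sum.cong[OF refl])
    fix s assume s: "s \<in> Pow E"
    then have "finite s" "e \<notin> s"
      using fin(1) E(2) finite_subset by auto
    then show "(- x) ^ card s * (\<Prod>i\<in>verts G. 1 - ?d s i) +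
        (- x) ^ card (insert e s) * (\<Prod>i\<in>verts G. 1 - ?d (insert e s) i) =
        (- x) ^ card s * ?R s * ((1 - ?d s u) * (1 - ?d s w) - x * (?d s u * ?d s w))"
      unfolding P R[OF s] using uw by (simp add: vdeg_insert algebra_simps)
  qed
  have sD: "signed_theta (delete_edge G e) x =
    (\<Sum>s\<in>Pow E. (- x) ^ card s * ?R s * ((1 - ?d s u) * (1 - ?d s w)))"
    unfolding signed_theta_def delete_edge_def vdeg_def using V fin(2) uw(2)
    by (simp add: E_def mult_ac)
  have "{u, w} \<subseteq> verts G"
    using V by auto
  then have sC: "signed_theta (contract_edge G e) x =
    (\<Sum>s\<in>Pow E. (- x) ^ card s * ?R s * (1 - ?d s u - ?d s w))"
    unfolding signed_theta_def verts_contract_edge[OF uw(1) \<open>{u, w} \<subseteq> verts G\<close>]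
  proof (intro sum.cong)
    fix s
    have "{u, w} \<notin> (\<lambda>v. {v}) ` V"
      using uw(2) by auto
    moreover have "(\<Prod>i\<in>V. 1 - of_nat (vdeg (contract_edge G e) s {i})) = (?R s :: 'r)"
      using V by (intro prod.cong refl) (metis vdeg_contract_edge(2)[OF uw])
    ultimately show "(- x) ^ card s *
        (\<Prod>i\<in>insert {u, w} ((\<lambda>v. {v}) ` (verts G - {u, w})).
          1 - of_nat (vdeg (contract_edge G e) s i)) =
        (- x) ^ card s * ?R s * (1 - ?d s u - ?d s w)"
      using fin(2) unfolding V_def[symmetric]
      by (simp add: prod.reindex inj_on_def vdeg_contract_edge(1)[OF uw] mult_ac algebra_simps)
  qed (simp add: contract_edge_def E_def)
  show ?thesis
    unfolding sG sD sC sum_distrib_left sum.distrib[symmetric]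
    by (intro sum.cong refl) (simp add: algebra_simps)
qed

text \<open>
  The coefficient \<open>1 - x\<close> of the deletion term is absorbed because deletion lowers \<open>card E - card V\<close>
  by one, whereas contraction, which loses an edge and a vertex, keeps it.
\<close>

theorem omega_delete_contract:
  assumes G: "finite_mgraph G" and e: "e \<in> edges G" and "\<not> is_loop G e"
  shows "omega G = omega (delete_edge G e) + [:0, 1:] * omega (contract_edge G e)"
proof (rule omega_eqI[OF G])
  obtain u w where uw: "ends G e = {#u, w#}"
    using G e size_2_mset_eq unfolding finite_mgraph_def by blast
  with assms(3) have "u \<noteq> w"
    unfolding is_loop_def by auto
  let ?D = "delete_edge G e" and ?C = "contract_edge G e" and ?q = "1 - [:0, 1:] :: int poly"
  have sub: "{u, w} \<subseteq> verts G" and fin: "finite (verts G)" "finite (edges G)"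
    using G e uw unfolding finite_mgraph_def by fastforce+
  have "{u, w} \<notin> (\<lambda>v. {v}) ` (verts G - {u, w})"
    using \<open>u \<noteq> w\<close> by auto
  then have "card (verts ?C) = Suc (card (verts G - {u, w}))"
    unfolding verts_contract_edge[OF uw sub] using fin by (simp add: card_image)
  moreover have "card {u, w} = 2"
    using \<open>u \<noteq> w\<close> by simp
  then have "card (verts G) = card (verts G - {u, w}) + 2"
    using sub fin by (metis card_Diff_subset card_mono finite.emptyI finite.insertI le_add_diff_inverse2)
  ultimately have VC: "card (verts G) = Suc (card (verts ?C))"
    by simp
  have VD: "verts ?D = verts G" and ED: "edges ?D = edges G - {e}" and EC: "edges ?C = edges G - {e}"
    unfolding delete_edge_def contract_edge_def by simp_all
  have EG: "card (edges G) = Suc (card (edges G - {e}))"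
    using e fin by (simp add: card_Suc_Diff1 del: card_Diff_insert)
  have "?q ^ card (verts G) * signed_theta G [:0, 1:] =
      ?q * (?q ^ card (verts G) * signed_theta ?D [:0, 1:]) +
      [:0, 1:] * (?q ^ card (verts G) * signed_theta ?C [:0, 1:])"
    unfolding signed_theta_delete_contract[OF G e uw \<open>u \<noteq> w\<close>] by algebra
  also have "?q ^ card (verts G) * signed_theta ?D [:0, 1:] = ?q ^ card (edges G - {e}) * omega ?D"
    using omega_spec[OF finite_mgraph_delete_edge[OF G, of e]] unfolding VD ED .
  also have "?q ^ card (verts G) * signed_theta ?C [:0, 1:] = ?q * (?q ^ card (edges G - {e}) * omega ?C)"
    using omega_spec[OF finite_mgraph_contract_edge[OF G, of e]] unfolding VC EC
    by (simp only: power_Suc mult.assoc)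
  finally show "?q ^ card (verts G) * signed_theta G [:0, 1:] =
      ?q ^ card (edges G) * (omega ?D + [:0, 1:] * omega ?C)"
    unfolding EG power_Suc by (simp only: distrib_left mult.assoc mult.left_commute)
qed

section \<open>Bouquets\<close>

lemma sum_Pow_power_card:
  fixes x :: "'a::comm_ring_1"
  assumes "finite E"
  shows "(\<Sum>s\<in>Pow E. (- x) ^ card s) = (1 - x) ^ card E"
  using sum_supersets_power_card[OF assms, of "{}" "- x"] by (simp add: Pow_def)

text \<open>
  A set of \<open>k\<close> loops has weight \<open>(- x)\<^sup>k (1 - 2 k)\<close>. The factor \<open>1 - x\<close> on the left keeps the
  formula valid for \<open>n = 0\<close>, where \<open>card E - card V = - 1\<close>.
\<close>

lemma signed_theta_bouquet:
  fixes x :: "'a::comm_ring_1"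
  shows "(1 - x) * signed_theta (bouquet n) x = (1 - x) ^ n * (1 + (2 * of_nat n - 1) * x)"
proof (induction n)
  case 0
  then show ?case
    by (simp add: signed_theta_def bouquet_def vdeg_def)
next
  case (Suc n)
  let ?w = "\<lambda>s :: nat set. (- x) ^ card s"
  have theta: "signed_theta (bouquet k) x = (\<Sum>s\<in>Pow {..<k}. ?w s * (1 - 2 * of_nat (card s)))" for k
    unfolding signed_theta_def bouquet_def vdeg_def
    by (simp add: mult.commute)
  have "signed_theta (bouquet (Suc n)) x =
      (\<Sum>s\<in>Pow {..<n}. (1 - x) * (?w s * (1 - 2 * of_nat (card s))) + 2 * x * ?w s)"
    unfolding theta lessThan_Suc sum_Pow_insert[OF finite_lessThan, of n n, simplified]
  proof (rule sum.cong[OF refl])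
    fix s assume "s \<in> Pow {..<n}"
    then have "finite s" "n \<notin> s"
      using finite_subset by auto
    then show "?w s * (1 - 2 * of_nat (card s)) +
        ?w (insert n s) * (1 - 2 * of_nat (card (insert n s))) =
        (1 - x) * (?w s * (1 - 2 * of_nat (card s))) + 2 * x * ?w s"
      by (simp add: algebra_simps)
  qed
  also have "\<dots> = (1 - x) * signed_theta (bouquet n) x + 2 * x * (1 - x) ^ n"
    unfolding theta by (simp add: sum.distrib sum_Pow_power_card flip: sum_distrib_left)
  finally show ?case
    unfolding Suc by (simp add: algebra_simps)
qed

theorem omega_bouquet: "omega (bouquet n) = [:1, 2 * int n - 1:]"
proof (rule omega_eqI[OF finite_mgraph_bouquet])
  have "[:1, 2 * int n - 1:] = 1 + (2 * of_nat n - 1) * [:0, 1:]"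
    by (simp add: of_nat_poly numeral_poly one_pCons)
  then show "(1 - [:0, 1:]) ^ card (verts (bouquet n)) * signed_theta (bouquet n) [:0, 1:] =
    (1 - [:0, 1:]) ^ card (edges (bouquet n)) * [:1, 2 * int n - 1:]"
    using signed_theta_bouquet[of "[:0, 1:] :: int poly" n] by (simp add: bouquet_def)
qed

section \<open>The core\<close>

text \<open>
  The factor \<open>1 - d\<close> at a leaf \<open>v\<close> is \<open>0\<close> for the edge sets that contain the edge at \<open>v\<close> and \<open>1\<close> for
  the others, which are the edge sets of the graph without \<open>v\<close>. The equations for the cardinalities
  say that \<open>card E - card V\<close> is kept.
\<close>

lemma signed_theta_delete_leaf:
  assumes G: "finite_mgraph G" and v: "v \<in> verts G" "vdeg G (edges G) v = 1"
  shows "signed_theta G x = signed_theta (delete_vertex G v) x"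
    and "card (verts G) = Suc (card (verts (delete_vertex G v)))"
    and "card (edges G) = Suc (card (edges (delete_vertex G v)))"
proof -
  define V where "V = verts G - {v}"
  define E where "E = {e \<in> edges G. v \<notin># ends G e}"
  have fin: "finite (edges G)" "finite E" "finite V" and V: "verts G = insert v V" "v \<notin> V"
    using G v(1) unfolding finite_mgraph_def V_def E_def by auto
  have "(\<Sum>e\<in>edges G. count (ends G e) v) = Suc 0"
    using v(2) unfolding vdeg_def by simp
  then obtain e where e: "e \<in> edges G" "count (ends G e) v = 1"
    "\<And>f. f \<in> edges G \<Longrightarrow> f \<noteq> e \<Longrightarrow> count (ends G f) v = 0"
    unfolding sum_eq_Suc0_iff[OF fin(1)] by auto
  have E: "edges G = insert e E" "e \<notin> E"
    using e unfolding E_def by (auto simp: not_in_iff)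
  have H: "edges (delete_vertex G v) = E" "verts (delete_vertex G v) = V"
    "vdeg (delete_vertex G v) = vdeg G"
    unfolding delete_vertex_def E_def V_def vdeg_def by (simp_all add: fun_eq_iff)
  show "card (verts G) = Suc (card (verts (delete_vertex G v)))"
    and "card (edges G) = Suc (card (edges (delete_vertex G v)))"
    using fin V E unfolding H by simp_all
  show "signed_theta G x = signed_theta (delete_vertex G v) x"
    unfolding signed_theta_def H E(1) sum_Pow_insert[OF fin(2) E(2)]
  proof (rule sum.cong[OF refl])
    fix s assume "s \<in> Pow E"
    then have "finite s" "e \<notin> s"
      using fin(2) E(2) finite_subset by auto
    moreover have "vdeg G s v = 0"
      using \<open>s \<in> Pow E\<close> unfolding vdeg_def E_def by (intro sum.neutral) (auto simp: not_in_iff)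
    ultimately show "(- x) ^ card s * (\<Prod>i\<in>verts G. 1 - of_nat (vdeg G s i)) +
        (- x) ^ card (insert e s) * (\<Prod>i\<in>verts G. 1 - of_nat (vdeg G (insert e s) i)) =
        (- x) ^ card s * (\<Prod>i\<in>V. 1 - of_nat (vdeg G s i))"
      using V fin(3) e(2) by (simp add: vdeg_insert)
  qed
qed

lemma omega_leaf_removal:
  assumes "finite_mgraph G" "leaf_removal G H"
  shows "finite_mgraph H \<and> omega G = omega H"
proof -
  obtain v where v: "v \<in> verts G" "vdeg G (edges G) v = 1" and H: "H = delete_vertex G v"
    using assms(2) unfolding leaf_removal_def by blast
  have "finite_mgraph H"
    unfolding H using assms(1) by (rule finite_mgraph_delete_vertex)
  moreover have "omega G = omega H"
    using omega_spec[OF \<open>finite_mgraph H\<close>] unfolding H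
    by (intro omega_eqI[OF assms(1)])
      (simp only: signed_theta_delete_leaf[OF assms(1) v] power_Suc mult.assoc)
  ultimately show ?thesis ..
qed

lemma omega_core:
  assumes "finite_mgraph G" "is_core G H"
  shows "finite_mgraph H \<and> omega G = omega H"
proof -
  have "leaf_removal\<^sup>*\<^sup>* G H"
    using assms(2) unfolding is_core_def by blast
  then show ?thesis
    by (induction rule: rtranclp_induct) (use assms(1) omega_leaf_removal in auto)
qed

section \<open>Degree and extreme coefficients\<close>

lemma coeff_0_omega:
  assumes "finite_mgraph G"
  shows "coeff (omega G) 0 = 1"
proof -
  have fin: "finite (edges G)"
    using assms unfolding finite_mgraph_def by blast
  have "poly (signed_theta G [:0, 1:]) 0 = (signed_theta G 0 :: int)"
    unfolding signed_theta_def by (simp add: poly_sum poly_prod of_nat_poly)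
  also have "\<dots> = (\<Sum>s\<in>{{}}. (- 0) ^ card s * (\<Prod>i\<in>verts G. 1 - of_nat (vdeg G s i)))"
    unfolding signed_theta_def using fin
    by (intro sum.mono_neutral_right) (auto simp: card_eq_0_iff dest: finite_subset)
  also have "\<dots> = 1"
    by (simp add: vdeg_def)
  finally have "poly ((1 - [:0, 1:]) ^ card (verts G) * signed_theta G [:0, 1:]) (0 :: int) = 1"
    by simp
  then show ?thesis
    unfolding omega_spec[OF assms] by (simp flip: poly_0_coeff_0)
qed

lemma signed_theta_monom:
  "signed_theta G [:0, 1:] = (\<Sum>s\<in>Pow (edges G).
     monom ((- 1) ^ card s * (\<Prod>i\<in>verts G. 1 - int (vdeg G s i))) (card s))"
proof -
  have "(\<Prod>i\<in>A. 1 - of_nat (d i)) = [:\<Prod>i\<in>A. 1 - int (d i):]" for A :: "'a set" and d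
    by (induction A rule: infinite_finite_induct) (simp_all add: of_nat_poly one_pCons)
  moreover have "(- [:0, 1:]) ^ n = monom ((- 1 :: int) ^ n) n" for n
    by (induction n) (simp_all add: monom_Suc minus_monom)
  ultimately show ?thesis
    unfolding signed_theta_def by (simp add: smult_monom mult.commute)
qed

text \<open>
  The coefficient of \<open>\<theta>\<close> at \<open>\<beta> ^ card E\<close> comes from \<open>s = E\<close> alone. It is \<open>\<Prod>i. 1 - d i\<close> up to sign,
  hence nonzero when no vertex has degree one. As \<open>\<omega>\<close> is a polynomial, comparing degrees and leading
  coefficients in \<open>(1 - \<beta>) ^ card V * \<theta> = (1 - \<beta>) ^ card E * \<omega>\<close> gives those of \<open>\<omega>\<close>.
\<close>

lemma degree_omega:
  assumes G: "finite_mgraph G" and no_leaf: "\<And>v. v \<in> verts G \<Longrightarrow> vdeg G (edges G) v \<noteq> 1"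
  shows "degree (omega G) = card (verts G)"
    and "lead_coeff (omega G) = (\<Prod>i\<in>verts G. int (vdeg G (edges G) i) - 1)"
proof -
  have fin: "finite (edges G)" "finite (verts G)"
    using G unfolding finite_mgraph_def by auto
  let ?T = "signed_theta G [:0, 1:] :: int poly" and ?q = "1 - [:0, 1:] :: int poly"
  let ?P = "\<Prod>i\<in>verts G. int (vdeg G (edges G) i) - 1"
  have q: "degree ?q = 1" "lead_coeff ?q = - 1" "?q \<noteq> 0"
    by (simp_all add: one_pCons)
  have "?P \<noteq> 0"
    using no_leaf fin by simp
  have "coeff ?T (card (edges G)) = (\<Sum>s\<in>Pow (edges G). if s = edges G
      then (- 1) ^ card s * (\<Prod>i\<in>verts G. 1 - int (vdeg G s i)) else 0)"
    unfolding signed_theta_monom coeff_sum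
    by (intro sum.cong refl) (use fin card_subset_eq in auto)
  also have "\<dots> = (- 1) ^ card (edges G) * (\<Prod>i\<in>verts G. - (int (vdeg G (edges G) i) - 1))"
    using fin by simp
  finally have top: "coeff ?T (card (edges G)) = (- 1) ^ card (edges G) * (- 1) ^ card (verts G) * ?P"
    by (simp only: prod_uminus mult.assoc)
  have "degree ?T \<le> card (edges G)"
    unfolding signed_theta_monom
    by (intro degree_sum_le) (use fin in \<open>auto intro!: order.trans[OF degree_monom_le] card_mono\<close>)
  moreover have "coeff ?T (card (edges G)) \<noteq> 0"
    unfolding top using \<open>?P \<noteq> 0\<close> by simp
  ultimately have deg: "degree ?T = card (edges G)" and "?T \<noteq> 0"
    by (auto intro: le_antisym le_degree)
  have "omega G \<noteq> 0"
    using coeff_0_omega[OF G] by auto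
  have "degree (?q ^ card (verts G) * ?T) = degree (?q ^ card (edges G) * omega G)"
    by (simp only: omega_spec[OF G])
  then show "degree (omega G) = card (verts G)"
    using q(1,3) \<open>?T \<noteq> 0\<close> \<open>omega G \<noteq> 0\<close> deg by (simp add: degree_mult_eq degree_power_eq)
  have "lead_coeff (?q ^ card (verts G) * ?T) = lead_coeff (?q ^ card (edges G) * omega G)"
    by (simp only: omega_spec[OF G])
  then have "(- 1) ^ card (edges G) * ((- 1) ^ (card (verts G) + card (verts G)) * ?P) =
      (- 1) ^ card (edges G) * lead_coeff (omega G)"
    unfolding lead_coeff_mult lead_coeff_power q(2) deg top by (simp only: power_add mult_ac)
  then show "lead_coeff (omega G) = ?P"
    by simp
qed

section \<open>Subdivision\<close>

lemma vdeg_subdivide_Inr: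
  assumes "finite s" "1 \<le> k" "k < m"
  shows "vdeg (subdivide m G) s (Inr (e, k)) = of_bool ((e, k - 1) \<in> s) + of_bool ((e, k) \<in> s)"
proof -
  have "count (ends (subdivide m G) (f, j)) (Inr (e, k)) =
      (if (f, j) = (e, k - 1) then 1 else 0) + (if (f, j) = (e, k) then 1 else 0)" for f j
    using assms(2,3) unfolding subdivide_def path_vertex_def by auto
  then have "vdeg (subdivide m G) s (Inr (e, k)) =
      (\<Sum>p\<in>s. (if p = (e, k - 1) then 1 else 0) + (if p = (e, k) then 1 else 0))"
    unfolding vdeg_def by (intro sum.cong refl) (metis surj_pair)
  then show ?thesis
    using assms(1) by (simp add: sum.distrib)
qed

lemma vdeg_subdivide_Inl:
  assumes G: "finite_mgraph G" and "s \<subseteq> edges G" "1 \<le> m"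
  shows "vdeg (subdivide m G) (s \<times> {..<m}) (Inl v) = vdeg G s v"
proof -
  have "(\<Sum>k<m. count (ends (subdivide m G) (e, k)) (Inl v)) = count (ends G e) v" if "e \<in> s" for e
  proof -
    let ?a = "fst (edge_pair G e)" and ?b = "snd (edge_pair G e)"
    have "count (ends (subdivide m G) (e, k)) (Inl v) =
        (if k = 0 then of_bool (?a = v) else 0) + (if k = m - 1 then of_bool (?b = v) else 0)"
      if "k < m" for k
      using that unfolding subdivide_def path_vertex_def by auto
    then have "(\<Sum>k<m. count (ends (subdivide m G) (e, k)) (Inl v)) =
        of_bool (?a = v) + of_bool (?b = v)"
      using assms(3) by (simp add: sum.distrib)
    also have "\<dots> = count (ends G e) v"
      using that assms(2) by (subst ends_edge_pair[OF G]) auto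
    finally show ?thesis .
  qed
  moreover have "(\<Sum>p\<in>s \<times> {..<m}. g p) = (\<Sum>e\<in>s. \<Sum>k<m. g (e, k))" for g :: "'b \<times> nat \<Rightarrow> nat"
    by (simp add: sum.cartesian_product)
  ultimately show ?thesis
    unfolding vdeg_def by simp
qed

text \<open>
  An inner vertex of a subdivided edge has degree \<open>0\<close>, \<open>1\<close> or \<open>2\<close>, hence factor \<open>1\<close>, \<open>0\<close> or
  \<open>- 1\<close>. So only the edge sets that contain each path entirely or not at all contribute, and these
  are the edge sets of \<open>G\<close>. A whole path has weight \<open>(- x)\<^sup>m (- 1) ^ (m - 1) = - x\<^sup>m\<close>.
\<close>

lemma signed_theta_subdivide:
  fixes x :: "'r::comm_ring_1"
  assumes G: "finite_mgraph G" and m: "1 \<le> m"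
  shows "signed_theta (subdivide m G) x = signed_theta G (x ^ m)"
proof -
  have fin: "finite (edges G)" "finite (verts G)"
    using G unfolding finite_mgraph_def by auto
  let ?S = "subdivide m G"
  let ?w = "\<lambda>s. (- x) ^ card s * (\<Prod>i\<in>verts ?S. 1 - of_nat (vdeg ?S s i))"
  let ?full = "\<lambda>s :: 'b set. s \<times> {..<m}"
  have ES: "edges ?S = edges G \<times> {..<m}" and VS: "verts ?S = verts G <+> edges G \<times> {1..<m}"
    unfolding subdivide_def by simp_all
  have vanish: "?w s = 0" if s: "s \<in> Pow (edges ?S) - ?full ` Pow (edges G)" for s
  proof (rule ccontr)
    assume "?w s \<noteq> 0"
    have "finite s"
      using s fin finite_subset unfolding ES by auto
    \<comment> \<open>Otherwise the vertex \<open>(e, k)\<close> would have degree one, and its factor would vanish.\<close>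
    have step: "(e, k - 1) \<in> s \<longleftrightarrow> (e, k) \<in> s" if "e \<in> edges G" "1 \<le> k" "k < m" for e k
    proof (rule ccontr)
      assume "\<not> ((e, k - 1) \<in> s \<longleftrightarrow> (e, k) \<in> s)"
      then have "vdeg ?S s (Inr (e, k)) = 1"
        using vdeg_subdivide_Inr[OF \<open>finite s\<close>, of k m G e] that by auto
      moreover have "Inr (e, k) \<in> verts ?S"
        unfolding VS using that by auto
      ultimately have "(\<Prod>i\<in>verts ?S. 1 - of_nat (vdeg ?S s i) :: 'r) = 0"
        using fin unfolding VS by (intro prod_zero) (auto intro!: bexI[of _ "Inr (e, k)"])
      with \<open>?w s \<noteq> 0\<close> show False
        by simp
    qed
    have all: "(e, k) \<in> s \<longleftrightarrow> (e, 0) \<in> s" if "e \<in> edges G" "k < m" for e k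
      using that(2) by (induction k) (use step[OF that(1)] in force)+
    have "s = ?full {e \<in> edges G. (e, 0) \<in> s}"
      using s all unfolding ES by auto
    then show False
      using s by blast
  qed
  have "inj_on ?full (Pow (edges G))"
  proof (rule inj_onI)
    fix s t assume "?full s = ?full t"
    then have "(e, 0) \<in> ?full s \<longleftrightarrow> (e, 0) \<in> ?full t" for e
      by simp
    then show "s = t"
      using m by auto
  qed
  have "signed_theta ?S x = (\<Sum>s\<in>?full ` Pow (edges G). ?w s)"
    unfolding signed_theta_def
    by (rule sum.mono_neutral_right) (use fin vanish in \<open>auto simp: ES\<close>)
  also have "\<dots> = (\<Sum>s\<in>Pow (edges G). ?w (?full s))"
    using \<open>inj_on ?full (Pow (edges G))\<close> by (simp add: sum.reindex)
  also have "\<dots> = signed_theta G (x ^ m)"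
    unfolding signed_theta_def
  proof (rule sum.cong[OF refl])
    fix s assume s: "s \<in> Pow (edges G)"
    then have "finite s"
      using fin finite_subset by auto
    have "(\<Prod>p\<in>edges G \<times> {1..<m}. 1 - of_nat (vdeg ?S (?full s) (Inr p)) :: 'r) =
        (\<Prod>e\<in>edges G. \<Prod>k\<in>{1..<m}. if e \<in> s then - 1 else 1)"
      unfolding prod.cartesian_product
      by (intro prod.cong refl) (use \<open>finite s\<close> in \<open>auto simp: vdeg_subdivide_Inr\<close>)
    also have "\<dots> = (\<Prod>e\<in>edges G. if e \<in> s then (- 1) ^ (m - 1) else 1)"
      by (intro prod.cong refl) simp
    also have "\<dots> = ((- 1) ^ (m - 1)) ^ card s"
      using s fin by (simp add: prod.If_cases Int_absorb1)
    finally have inner: "(\<Prod>p\<in>edges G \<times> {1..<m}. 1 - of_nat (vdeg ?S (?full s) (Inr p)) :: 'r) =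
        ((- 1) ^ (m - 1)) ^ card s" .
    obtain j where j: "m = Suc j"
      using m by (cases m) auto
    have "(- x) ^ j * (- 1) ^ j = x ^ j"
      by (simp flip: power_mult_distrib)
    then have sign: "(- x) ^ m * (- 1) ^ (m - 1) = - (x ^ m)"
      unfolding j by (simp add: mult.assoc)
    have "(- x) ^ card (?full s) = ((- x) ^ m) ^ card s"
      by (simp add: card_cartesian_product mult.commute flip: power_mult)
    then have weight: "(- x) ^ card (?full s) * ((- 1) ^ (m - 1)) ^ card s = (- (x ^ m)) ^ card s"
      by (simp only: sign flip: power_mult_distrib)
    have "(\<Prod>i\<in>verts ?S. 1 - of_nat (vdeg ?S (?full s) i) :: 'r) =
        (\<Prod>v\<in>verts G. 1 - of_nat (vdeg ?S (?full s) (Inl v))) * ((- 1) ^ (m - 1)) ^ card s"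
      unfolding VS inner[symmetric] using fin by (simp add: prod.Plus)
    also have "(\<Prod>v\<in>verts G. 1 - of_nat (vdeg ?S (?full s) (Inl v)) :: 'r) =
        (\<Prod>v\<in>verts G. 1 - of_nat (vdeg G s v))"
      using s by (simp add: vdeg_subdivide_Inl[OF G _ m])
    finally show "?w (?full s) = (- (x ^ m)) ^ card s * (\<Prod>i\<in>verts G. 1 - of_nat (vdeg G s i))"
      unfolding weight[symmetric] by (simp only: mult_ac)
  qed
  finally show ?thesis .
qed

lemma pcompose_power: "pcompose (p ^ n) r = pcompose p r ^ n"
  for p r :: "'a::comm_ring_1 poly"
  by (induction n) (simp_all add: pcompose_mult pcompose_1)

lemma pcompose_signed_theta:
  "pcompose (signed_theta G [:0, 1:]) p = signed_theta G p" for p :: "int poly"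
proof -
  have "pcompose [:0, 1:] p = p" and "pcompose (of_nat n) p = of_nat n" for n
    by (simp_all add: pcompose_pCons of_nat_poly)
  then show ?thesis
    unfolding signed_theta_def
    by (simp only: pcompose_sum pcompose_mult pcompose_power pcompose_prod pcompose_uminus
        pcompose_diff pcompose_1)
qed

text \<open>
  With \<open>q = 1 - \<beta>\<close> and \<open>r = 1 + \<beta> + \<dots> + \<beta> ^ (m - 1)\<close>, so that \<open>q r = 1 - \<beta>\<^sup>m\<close>, the polynomials
  \<open>\<omega>\<close> of \<open>G\<close> at \<open>\<beta>\<^sup>m\<close> and of the subdivision at \<open>\<beta>\<close> are the same \<open>\<theta>\<close> divided by
  \<open>(q r) ^ (card E - card V)\<close> and \<open>q ^ (card E - card V)\<close>, since subdividing an edge adds as many edges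
  as vertices.
\<close>

theorem omega_subdivide:
  assumes G: "finite_mgraph G" and m: "1 \<le> m"
  shows "to_fract (omega (subdivide m G)) =
    to_fract (\<Sum>k<m. [:0, 1:] ^ k) powi (int (card (edges G)) - int (card (verts G))) *
    to_fract (pcompose (omega G) ([:0, 1:] ^ m))"
proof -
  let ?S = "subdivide m G"
  let ?X = "[:0, 1:] :: int poly"
  define q where "q = 1 - ?X"
  define r where "r = (\<Sum>k<m. ?X ^ k)"
  define V where "V = card (verts G)"
  define E where "E = card (edges G)"
  define w where "w = pcompose (omega G) (?X ^ m)"
  have fin: "finite (edges G)" "finite (verts G)"
    using G unfolding finite_mgraph_def by auto
  have qr: "q * r = 1 - ?X ^ m"
    unfolding q_def r_def by (rule one_diff_power_eq[symmetric])
  have "q \<noteq> 0"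
    unfolding q_def by (simp add: one_pCons)
  have "poly r 0 = 1"
    unfolding r_def using m by (simp add: poly_sum power_0_left)
  then have "r \<noteq> 0"
    by auto
  have cards: "card (verts ?S) = V + E * (m - 1)" "card (edges ?S) = E + E * (m - 1)"
    using fin m unfolding subdivide_def V_def E_def
    by (simp_all add: card_Plus card_cartesian_product algebra_simps flip: mult_Suc_right)
  have "q ^ (E * (m - 1)) * (q ^ V * signed_theta G (?X ^ m)) =
      q ^ (E * (m - 1)) * (q ^ E * omega ?S)"
    using omega_spec[OF finite_mgraph_subdivide[OF G, of m]]
    unfolding cards signed_theta_subdivide[OF G m] q_def[symmetric]
    by (simp only: power_add mult_ac)
  then have sub: "q ^ V * signed_theta G (?X ^ m) = q ^ E * omega ?S"
    using \<open>q \<noteq> 0\<close> by simp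
  have "pcompose q (?X ^ m) = 1 - ?X ^ m"
    unfolding q_def by (simp add: pcompose_diff pcompose_1 pcompose_pCons)
  then have "pcompose q (?X ^ m) = q * r"
    unfolding qr .
  then have "(q * r) ^ V * signed_theta G (?X ^ m) = (q * r) ^ E * w"
    using arg_cong[OF omega_spec[OF G], of "\<lambda>p. pcompose p (?X ^ m)"]
    unfolding q_def[symmetric] V_def E_def w_def
    by (simp only: pcompose_mult pcompose_power pcompose_signed_theta)
  then have "r ^ V * (q ^ V * signed_theta G (?X ^ m)) = q ^ E * (r ^ E * w)"
    by (simp only: power_mult_distrib mult_ac)
  then have "q ^ E * (r ^ V * omega ?S) = q ^ E * (r ^ E * w)"
    unfolding sub by (simp only: mult.left_commute)
  then have "r ^ V * omega ?S = r ^ E * w"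
    using \<open>q \<noteq> 0\<close> by simp
  then have "to_fract r ^ V * to_fract (omega ?S) = to_fract r ^ E * to_fract w"
    by (simp only: flip: to_fract_mult to_fract_power)
  moreover have "to_fract r \<noteq> 0"
    using \<open>r \<noteq> 0\<close> by simp
  ultimately have "to_fract (omega ?S) = to_fract r powi (int E - int V) * to_fract w"
    by (simp add: power_int_diff nonzero_eq_divide_eq mult.commute)
  then show ?thesis
    unfolding r_def w_def V_def E_def .
qed

theorem proposition3:
  shows
    "(\<forall>(G\<^sub>1 :: ('a, 'b) mgraph) (G\<^sub>2 :: ('c, 'd) mgraph).
        finite_mgraph G\<^sub>1 \<longrightarrow> finite_mgraph G\<^sub>2 \<longrightarrow>
        omega (disjoint_union G\<^sub>1 G\<^sub>2) = omega G\<^sub>1 * omega G\<^sub>2) \<and>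
     (\<forall>(G :: ('a, 'b) mgraph) e.
        finite_mgraph G \<longrightarrow> e \<in> edges G \<longrightarrow> \<not> is_loop G e \<longrightarrow>
        omega G = omega (delete_edge G e) + [:0, 1:] * omega (contract_edge G e)) \<and>
     (\<forall>n. omega (bouquet n) = [:1, 2 * int n - 1:]) \<and>
     (\<forall>(G :: ('a, 'b) mgraph) H.
        finite_mgraph G \<longrightarrow> is_core G H \<longrightarrow> omega G = omega H) \<and>
     (\<forall>G :: ('a, 'b) mgraph.
        finite_mgraph G \<longrightarrow>
        omega_fract G = to_fract (map_poly of_int (omega G)) \<and>
        coeff (omega G) 0 = 1 \<and>
        (\<forall>H. is_core G H \<longrightarrow>
           degree (omega G) = card (verts H) \<and>
           lead_coeff (omega G) = (\<Prod>i\<in>verts H. int (vdeg H (edges H) i) - 1))) \<and>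
     (\<forall>(G :: ('a, 'b) mgraph) m.
        finite_mgraph G \<longrightarrow> 1 \<le> m \<longrightarrow>
        to_fract (omega (subdivide m G)) =
          to_fract (\<Sum>k<m. [:0, 1:] ^ k) powi (int (card (edges G)) - int (card (verts G))) *
          to_fract (pcompose (omega G) ([:0, 1:] ^ m)))"
proof (intro conjI allI impI)
  fix G H :: "('a, 'b) mgraph"
  assume G: "finite_mgraph G"
  show "omega_fract G = to_fract (map_poly of_int (omega G))"
    using G by (rule omega_fract_eq_omega)
  show "coeff (omega G) 0 = 1"
    using G by (rule coeff_0_omega)
  assume core: "is_core G H"
  note H = omega_core[OF G core]
  show "omega G = omega H"
    using H ..
  show "degree (omega G) = card (verts H)"
    and "lead_coeff (omega G) = (\<Prod>i\<in>verts H. int (vdeg H (edges H) i) - 1)"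
    using degree_omega[of H] H core unfolding is_core_def by simp_all
next
  fix G :: "('a, 'b) mgraph" and m :: nat
  assume "finite_mgraph G" "1 \<le> m"
  then show "to_fract (omega (subdivide m G)) =
      to_fract (\<Sum>k<m. [:0, 1:] ^ k) powi (int (card (edges G)) - int (card (verts G))) *
      to_fract (pcompose (omega G) ([:0, 1:] ^ m))"
    by (rule omega_subdivide)
qed (rule omega_disjoint_union omega_delete_contract omega_bouquet; assumption)+

end
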